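(* Let $a\ge1$ be real, $\alpha>\beta>0$, $T>0$, $\delta>0$. Let $u_0,u_1$ be functions on $[0,\delta]$ satisfying, for all $x\in[0,\delta]$, $$K_0x^\alpha\le u_0(x)\le K_1x^\alpha,\qquad K_2x^\beta\le u_1(x)\le K_3x^\beta,$$ with positive constants $K_0,\dots,K_3$. Let $u$ be a solution of $$u_{tt}=u^a\bigl(u^{a}u_x\bigr)_x,\qquad u(0,x)=u_0(x),\quad u_t(0,x)=u_1(x),$$ such that $$u\in C^2([0,T]\times(0,\delta])\cap C([0,T]\times[0,\delta]),\qquad u_t,\ u^{a-1}u_x\in C([0,T]\times[0,\delta]),$$ $$u(t,0)=u_t(t,0)=0\ \ (t\in[0,T]),\qquad u(t,x)\ge0\ \ ((t,x)\in[0,T]\times[0,\delta]).$$ Then, provided that $T>0$ is sufficiently small, $u$ satisfies $$C_1\,t\,x^\beta\le u(t,x)\le C_2\,x^\beta .$$ That is, there exist $T_1\in(0,T]$, $\delta_1\in(0,\delta)$ and constants $C_1,C_2>0$ such that this estimate holds for all $(t,x)\in[0,T_1]\times[0,\delta_1]$.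
   Context: All functions are real-valued. The equation is required to hold pointwise for $(t,x)\in[0,T]\times(0,\delta]$, with one-sided derivatives at the endpoints $t=0$, $t=T$, $x=\delta$. The conditions $u_t,\ u^{a-1}u_x\in C([0,T]\times[0,\delta])$ mean that these functions, defined on $[0,T]\times(0,\delta]$, extend continuously up to $x=0$ (for $a=1$, $u^{a-1}=1$). The numbers $T_1,\delta_1,C_1,C_2$ may depend on the data, the constants and the solution $u$, but not on $(t,x)$. *)

theory Defs
  imports "HOL-Analysis.Analysis"
begin

text \<open>
  Derivatives are taken within the slices of the domain \<open>D\<close>, so that they are one-sided at the
  points of \<open>D\<close> where only a one-sided derivative makes sense. \<open>vector_derivative\<close> is the library's
  derivative within a set for functions of a real variable.
\<close>

definition partial_t :: "(real \<times> real) set \<Rightarrow> (real \<Rightarrow> real \<Rightarrow> real) \<Rightarrow> real \<Rightarrow> real \<Rightarrow> real" where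
  "partial_t D u t x = vector_derivative (\<lambda>s. u s x) (at t within {s. (s, x) \<in> D})"

definition partial_x :: "(real \<times> real) set \<Rightarrow> (real \<Rightarrow> real \<Rightarrow> real) \<Rightarrow> real \<Rightarrow> real \<Rightarrow> real" where
  "partial_x D u t x = vector_derivative (\<lambda>y. u t y) (at x within {y. (t, y) \<in> D})"

definition partially_differentiable_on ::
    "(real \<Rightarrow> real \<Rightarrow> real) \<Rightarrow> (real \<times> real) set \<Rightarrow> bool" where
  "partially_differentiable_on u D \<longleftrightarrow>
     (\<forall>(t, x) \<in> D. (\<lambda>s. u s x) differentiable (at t within {s. (s, x) \<in> D}) \<and>
                   (\<lambda>y. u t y) differentiable (at x within {y. (t, y) \<in> D}))"

text \<open>All partial derivatives up to order \<open>k\<close>, in every order of differentiation, exist and are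
  jointly continuous on \<open>D\<close>.\<close>

fun Ck_on :: "nat \<Rightarrow> (real \<times> real) set \<Rightarrow> (real \<Rightarrow> real \<Rightarrow> real) \<Rightarrow> bool" where
  "Ck_on 0 D u \<longleftrightarrow> continuous_on D (\<lambda>(t, x). u t x)"
| "Ck_on (Suc k) D u \<longleftrightarrow> continuous_on D (\<lambda>(t, x). u t x) \<and> partially_differentiable_on u D \<and>
     Ck_on k D (partial_t D u) \<and> Ck_on k D (partial_x D u)"

text \<open>
  The library has \<open>0 powr 0 = 0\<close>, but for \<open>a = 1\<close> the factor \<open>u\<^sup>a\<^sup>-\<^sup>1\<close> means \<open>1\<close>, also where \<open>u\<close>
  vanishes. For positive exponents this is \<open>powr\<close>.
\<close>

definition pow01 :: "real \<Rightarrow> real \<Rightarrow> real" where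
  "pow01 y b = (if b = 0 then 1 else y powr b)"

text \<open>\<open>g\<close> is a continuous extension to \<open>Q\<close> of the function \<open>f\<close> defined on \<open>D\<close>.\<close>

definition continuous_extension ::
    "(real \<times> real) set \<Rightarrow> (real \<times> real) set \<Rightarrow> (real \<Rightarrow> real \<Rightarrow> real) \<Rightarrow> (real \<Rightarrow> real \<Rightarrow> real) \<Rightarrow> bool" where
  "continuous_extension D Q f g \<longleftrightarrow>
     continuous_on Q (\<lambda>(t, x). g t x) \<and> (\<forall>(t, x) \<in> D. g t x = f t x)"

end

theory Submission
  imports Defs
begin

text \<open>
  The Riemann variables \<open>R = u\<^sub>t + u\<^sup>a u\<^sub>x\<close> and \<open>S = u\<^sub>t - u\<^sup>a u\<^sub>x\<close> solve the system
  \<open>R\<^sub>t - c R\<^sub>x = q (R + S)\<close>, \<open>S\<^sub>t + c S\<^sub>x = - q (R + S)\<close> with \<open>c = u\<^sup>a\<close> and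
  \<open>q = (a/2) u\<^sup>a\<^sup>-\<^sup>1 u\<^sub>x\<close>. By hypothesis \<open>q\<close> is bounded, so \<open>c\<close>, which vanishes at \<open>x = 0\<close>,
  is at most \<open>\<Lambda> x\<close>: on a trapezoid that shrinks fast enough the characteristics can be followed
  backwards to \<open>t = 0\<close> without reaching \<open>x = 0\<close>. Moreover \<open>u\<^sup>a u\<^sub>x = u (u\<^sup>a\<^sup>-\<^sup>1 u\<^sub>x)\<close> is
  \<open>O(x\<^sup>\<alpha>)\<close> at \<open>t = 0\<close>, hence \<open>R\<close> and \<open>S\<close> are initially comparable to \<open>x\<^sup>\<beta>\<close>. A minimum
  principle along characteristics shows that this persists for a short time with constants
  independent of the trapezoid. Then \<open>u\<^sub>t = (R + S)/2\<close> is comparable to \<open>x\<^sup>\<beta>\<close>, and one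
  integrates in \<open>t\<close>.
\<close>

section \<open>Calculus in the plane and powers at zero\<close>

text \<open>The second difference of \<open>f\<close> over a small square of side \<open>h\<close>
  is \<open>h * h\<close> times a value of \<open>ftx\<close>, and also \<open>h * h\<close> times a
  value of \<open>fxt\<close>, by applying the mean value theorem twice in either order. Continuity
  forces both values close to those at the corner. The equations for the Riemann variables need
  this, since \<open>Ck_on\<close> provides both mixed derivatives without identifying them.\<close>

lemma mixed_partials_eq:
  fixes f ft fx ftx fxt :: "real \<Rightarrow> real \<Rightarrow> real"
  assumes "open G" and "(t0, x0) \<in> G"
    and ft: "\<And>t x. (t, x) \<in> G \<Longrightarrow> ((\<lambda>s. f s x) has_real_derivative ft t x) (at t)"
    and fx: "\<And>t x. (t, x) \<in> G \<Longrightarrow> ((\<lambda>y. f t y) has_real_derivative fx t x) (at x)"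
    and ftx: "\<And>t x. (t, x) \<in> G \<Longrightarrow> ((\<lambda>y. ft t y) has_real_derivative ftx t x) (at x)"
    and fxt: "\<And>t x. (t, x) \<in> G \<Longrightarrow> ((\<lambda>s. fx s x) has_real_derivative fxt t x) (at t)"
    and cont: "continuous_on G (\<lambda>(t, x). ftx t x)" "continuous_on G (\<lambda>(t, x). fxt t x)"
  shows "ftx t0 x0 = fxt t0 x0"
proof (rule ccontr)
  assume ne: "ftx t0 x0 \<noteq> fxt t0 x0"
  define g where "g = (\<lambda>z. ftx (fst z) (snd z))"
  define k where "k = (\<lambda>z. fxt (fst z) (snd z))"
  \<comment> \<open>Half the supposed gap: a common value within \<open>e\<close> of both numbers is
    then impossible.\<close>
  define e where "e = \<bar>ftx t0 x0 - fxt t0 x0\<bar> / 2"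
  have e: "e > 0" using ne by (simp add: e_def)
  have "isCont g (t0, x0)" "isCont k (t0, x0)"
    using cont assms(1,2) by (auto simp: g_def k_def continuous_on_eq_continuous_at split_beta)
  then have "\<forall>\<^sub>F z in nhds (t0, x0). dist (g z) (g (t0, x0)) < e"
    "\<forall>\<^sub>F z in nhds (t0, x0). dist (k z) (k (t0, x0)) < e"
    using e by (auto simp: continuous_at tendsto_at_iff_tendsto_nhds dest!: tendstoD)
  moreover have "\<forall>\<^sub>F z in nhds (t0, x0). z \<in> G"
    using assms(1,2) by (rule eventually_nhds_in_open)
  ultimately have "\<forall>\<^sub>F z in nhds (t0, x0).
      z \<in> G \<and> dist (g z) (g (t0, x0)) < e \<and> dist (k z) (k (t0, x0)) < e"
    by eventually_elim auto
  then obtain d where d: "d > 0" and near: "\<And>z. dist z (t0, x0) < d \<Longrightarrow>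
      z \<in> G \<and> dist (g z) (g (t0, x0)) < e \<and> dist (k z) (k (t0, x0)) < e"
    by (auto simp: eventually_nhds_metric)
  \<comment> \<open>The two coordinate offsets add up to at most \<open>2 * d / 3\<close>, so the
    whole square lies in the ball of radius \<open>d\<close>.\<close>
  define h where "h = d / 3"
  have h: "h > 0" using d by (simp add: h_def)
  have box: "dist (t, x) (t0, x0) < d" if "t \<in> {t0..t0+h}" "x \<in> {x0..x0+h}" for t x
  proof -
    have "dist (t, x) (t0, x0) \<le> \<bar>t - t0\<bar> + \<bar>x - x0\<bar>"
      using norm_Pair_le[of "t - t0" "x - x0"] by (simp add: dist_norm)
    also have "\<dots> < d" using that d by (auto simp: h_def)
    finally show ?thesis .
  qed
  note inG = near[OF box, THEN conjunct1]
  define \<Delta> where "\<Delta> = f (t0+h) (x0+h) - f (t0+h) x0 - (f t0 (x0+h) - f t0 x0)"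
  have "\<exists>s. t0 < s \<and> s < t0+h \<and>
      (f (t0+h) (x0+h) - f (t0+h) x0) - (f t0 (x0+h) - f t0 x0) = (t0+h-t0) * (ft s (x0+h) - ft s x0)"
    using h by (intro MVT2[where f="\<lambda>s. f s (x0+h) - f s x0"] DERIV_diff ft inG) auto
  then obtain s where s: "t0 < s" "s < t0+h" "\<Delta> = h * (ft s (x0+h) - ft s x0)"
    by (auto simp: \<Delta>_def)
  have "\<exists>y. x0 < y \<and> y < x0+h \<and> ft s (x0+h) - ft s x0 = (x0+h-x0) * ftx s y"
    using h s by (intro MVT2 ftx inG) auto
  then obtain y where y: "x0 < y" "y < x0+h" "\<Delta> = h * (h * ftx s y)"
    using s by auto
  have "\<exists>y. x0 < y \<and> y < x0+h \<and>
      (f (t0+h) (x0+h) - f t0 (x0+h)) - (f (t0+h) x0 - f t0 x0) = (x0+h-x0) * (fx (t0+h) y - fx t0 y)"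
    using h by (intro MVT2[where f="\<lambda>y. f (t0+h) y - f t0 y"] DERIV_diff fx inG) auto
  then obtain y' where y': "x0 < y'" "y' < x0+h" "\<Delta> = h * (fx (t0+h) y' - fx t0 y')"
    by (auto simp: \<Delta>_def algebra_simps)
  have "\<exists>s. t0 < s \<and> s < t0+h \<and> fx (t0+h) y' - fx t0 y' = (t0+h-t0) * fxt s y'"
    using h y' by (intro MVT2 fxt inG) auto
  then obtain s' where s': "t0 < s'" "s' < t0+h" "\<Delta> = h * (h * fxt s' y')"
    using y' by auto
  have "ftx s y = fxt s' y'" using y(3) s'(3) h by simp
  moreover have "\<bar>ftx s y - ftx t0 x0\<bar> < e" "\<bar>fxt s' y' - fxt t0 x0\<bar> < e"
    using near[OF box, of s y] near[OF box, of s' y'] s y s' y' by (auto simp: g_def k_def dist_norm)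
  ultimately show False by (simp add: e_def abs_if split: if_splits)
qed

text \<open>Continuity of the partial derivative in \<open>x\<close>, with existence of the other
  one at the point, gives total differentiability. For \<open>ut\<close> and \<open>F\<close> it is
  then enough to know that \<open>utx\<close> and \<open>Fx\<close> are continuous.\<close>

lemma has_derivative_from_partials:
  fixes f ft fx :: "real \<Rightarrow> real \<Rightarrow> real"
  assumes ft: "((\<lambda>s. f s x) has_real_derivative ft t x) (at t)"
    and fx: "\<And>s y. s \<in> {t1<..<t2} \<Longrightarrow> y \<in> {x1<..<x2} \<Longrightarrow>
      ((\<lambda>y. f s y) has_real_derivative fx s y) (at y)"
    and cont: "continuous_on ({t1<..<t2} \<times> {x1<..<x2}) (\<lambda>(t, x). fx t x)"
    and t: "t \<in> {t1<..<t2}" and x: "x \<in> {x1<..<x2}"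
  shows "((\<lambda>(t, x). f t x) has_derivative (\<lambda>(s, y). ft t x * s + fx t x * y)) (at (t, x))"
proof -
  let ?X = "{t1<..<t2}" and ?Y = "{x1<..<x2}"
  \<comment> \<open>The partial derivative in \<open>x\<close> is presented as a bounded linear map,
    the form in which \<open>has_derivative_partialsI\<close> takes it.\<close>
  have blinfun: "blinfun_apply (k *\<^sub>R id_blinfun) = (*) k" for k :: real
    by (simp add: fun_eq_iff blinfun.scaleR_left)
  have op: "open (?X \<times> ?Y)" by (intro open_Times open_greaterThanLessThan)
  have "((\<lambda>(t, x). f t x) has_derivative (\<lambda>(s, y). ft t x * s + blinfun_apply (fx t x *\<^sub>R id_blinfun) y))
      (at (t, x) within ?X \<times> ?Y)"
  proof (rule has_derivative_partialsI)
    show "((\<lambda>s. f s x) has_derivative (*) (ft t x)) (at t within ?X)"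
      using ft by (auto simp: has_field_derivative_def intro: has_derivative_at_withinI)
    show "((\<lambda>y. f s y) has_derivative blinfun_apply (fx s y *\<^sub>R id_blinfun)) (at y within ?Y)"
      if "s \<in> ?X" "y \<in> ?Y" for s y
      using fx[OF that] unfolding blinfun has_field_derivative_def by (rule has_derivative_at_withinI)
    have "continuous_on (?X \<times> ?Y) (\<lambda>z. (case z of (t, x) \<Rightarrow> fx t x) *\<^sub>R (id_blinfun :: real \<Rightarrow>\<^sub>L real))"
      using cont by (intro continuous_intros)
    then show "continuous (at (t, x) within ?X \<times> ?Y) (\<lambda>(s, y). fx s y *\<^sub>R (id_blinfun :: real \<Rightarrow>\<^sub>L real))"
      using t x by (simp add: continuous_on_eq_continuous_within split_beta')
  qed (use x in auto)
  then show ?thesis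
    using at_within_open[OF _ op, of "(t, x)"] t x
    by (simp add: blinfun)
qed

text \<open>At \<open>y = 0\<close> the difference quotient is \<open>h powr (a - 1)\<close>, which
  tends to 0 for \<open>a > 1\<close> and equals 1 for \<open>a = 1\<close>; \<open>pow01\<close>
  records both cases. The one-sided form allows differentiating \<open>u powr a\<close> knowing only
  that \<open>u\<close> is nonnegative.\<close>

lemma has_real_derivative_powr_nonneg:
  fixes y a :: real
  assumes "a \<ge> 1" "y \<ge> 0"
  shows "((\<lambda>y. y powr a) has_real_derivative a * pow01 y (a - 1)) (at y within {0..})"
proof (cases "y = 0")
  case False
  then have "((\<lambda>y. y powr a) has_real_derivative a * y powr (a - 1)) (at y)"
    using assms by (intro has_real_derivative_powr) auto
  then show ?thesis using False assms by (auto simp: pow01_def intro: DERIV_subset)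
next
  case True
  \<comment> \<open>The factor \<open>a\<close> in the limit is harmless: either
    \<open>a = 1\<close>, or \<open>pow01 0 (a - 1)\<close> is 0.\<close>
  have "((\<lambda>h. pow01 h (a - 1)) \<longlongrightarrow> a * pow01 0 (a - 1)) (at 0 within {0..})"
  proof (cases "a = 1")
    case False
    then have "((\<lambda>h::real. h powr (a - 1)) \<longlongrightarrow> 0 powr (a - 1)) (at 0 within {0..})"
      using assms by (intro tendsto_powr') (auto simp: eventually_at_filter intro: tendsto_ident_at)
    then show ?thesis using False by (simp add: pow01_def)
  qed (auto simp: pow01_def)
  moreover have "\<forall>\<^sub>F h in at 0 within {0..}. pow01 h (a - 1) = ((0 + h) powr a - 0 powr a) / (h::real)"
    by (auto simp: eventually_at_filter pow01_def powr_diff)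
  ultimately show ?thesis
    unfolding True has_field_derivative_iff
    by (simp add: tendsto_cong)
qed

lemma powr_eq_mult_pow01: "y \<ge> 0 \<Longrightarrow> y powr a = y * pow01 y (a - 1)" for y a :: real
  by (cases "y = 0") (auto simp: pow01_def powr_diff)

lemma continuous_on_pow01:
  fixes f :: "'a::topological_space \<Rightarrow> real"
  assumes "continuous_on A f" "\<And>z. z \<in> A \<Longrightarrow> f z \<ge> 0" "b \<ge> 0"
  shows "continuous_on A (\<lambda>z. pow01 (f z) b)"
  using assms by (cases "b = 0") (auto simp: pow01_def intro!: continuous_on_powr')

section \<open>Trapezoids that contain the backward characteristics\<close>

text \<open>
  The factors \<open>1 - \<Lambda> t\<close> make the straight backward step \<open>(t - h, x - c h)\<close> with
  \<open>\<bar>c\<bar> \<le> \<Lambda> x\<close> stay inside exactly, not only up to second order in \<open>h\<close>; with the exponential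
  lower boundary this fails.
\<close>

definition trapezoid :: "real \<Rightarrow> real \<Rightarrow> real \<Rightarrow> real \<Rightarrow> (real \<times> real) set" where
  "trapezoid \<Lambda> \<tau> l r = {(t, x). 0 \<le> t \<and> t \<le> \<tau> \<and> l \<le> x * (1 - \<Lambda> * t) \<and> x \<le> r * (1 - \<Lambda> * t)}"

lemma mem_trapezoid:
  "(t, x) \<in> trapezoid \<Lambda> \<tau> l r \<longleftrightarrow> 0 \<le> t \<and> t \<le> \<tau> \<and> l \<le> x * (1 - \<Lambda> * t) \<and> x \<le> r * (1 - \<Lambda> * t)"
  by (simp add: trapezoid_def)

lemma trapezoid_bounds:
  assumes tx: "(t, x) \<in> trapezoid \<Lambda> \<tau> l r" and "0 < l" "\<Lambda> \<ge> 0" "\<Lambda> * \<tau> < 1"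
  shows "l \<le> x" "x \<le> r" "0 < 1 - \<Lambda> * t"
proof -
  have t: "0 \<le> t" "t \<le> \<tau>" "l \<le> x * (1 - \<Lambda> * t)" "x \<le> r * (1 - \<Lambda> * t)"
    using tx by (auto simp: mem_trapezoid)
  have "\<Lambda> * t \<le> \<Lambda> * \<tau>" using t assms by (intro mult_left_mono) auto
  then show e: "0 < 1 - \<Lambda> * t" using assms by linarith
  have e1: "1 - \<Lambda> * t \<le> 1" using t assms by simp
  have x: "0 < x" using t(3) e assms(2) by (smt (verit) mult_nonneg_nonneg mult_nonpos_nonneg)
  then have "x * (1 - \<Lambda> * t) \<le> x" using e1 by (intro mult_left_le) auto
  then show "l \<le> x" using t by linarith
  have "0 < r" using x t(4) e by (smt (verit) mult_nonpos_nonneg)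
  then have "r * (1 - \<Lambda> * t) \<le> r" using e1 by (intro mult_left_le) auto
  then show "x \<le> r" using t by linarith
qed

lemma compact_trapezoid:
  assumes "0 < l" "\<Lambda> \<ge> 0" "\<Lambda> * \<tau> < 1"
  shows "compact (trapezoid \<Lambda> \<tau> l r)"
proof -
  have eq: "trapezoid \<Lambda> \<tau> l r = {z. 0 \<le> fst z} \<inter> {z. fst z \<le> \<tau>} \<inter>
      {z. l \<le> snd z * (1 - \<Lambda> * fst z)} \<inter> {z. snd z \<le> r * (1 - \<Lambda> * fst z)}"
    by (auto simp: trapezoid_def)
  have "closed (trapezoid \<Lambda> \<tau> l r)"
    unfolding eq by (intro closed_Int closed_Collect_le continuous_intros)
  moreover have "trapezoid \<Lambda> \<tau> l r \<subseteq> {0..\<tau>} \<times> {l..r}"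
  proof (rule subrelI)
    fix t x assume tx: "(t, x) \<in> trapezoid \<Lambda> \<tau> l r"
    then show "(t, x) \<in> {0..\<tau>} \<times> {l..r}"
      using trapezoid_bounds(1,2)[OF tx assms] by (simp add: mem_trapezoid)
  qed
  then have "bounded (trapezoid \<Lambda> \<tau> l r)"
    by (rule bounded_subset[rotated]) (intro bounded_Times bounded_closed_interval)
  ultimately show ?thesis by (simp add: compact_eq_bounded_closed)
qed

text \<open>The step multiplies \<open>x\<close> by a factor between
  \<open>1 - \<Lambda> * h\<close> and \<open>1 + \<Lambda> * h\<close>. Combined with the affine
  boundary factors this leaves only the second-order terms
  \<open>(\<Lambda> * h) * (\<Lambda> * t - \<Lambda> * h)\<close> on the left and
  \<open>- (\<Lambda> * t) * (\<Lambda> * h)\<close> on the right, both of the favourable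
  sign.\<close>

lemma trapezoid_backward:
  assumes tx: "(t, x) \<in> trapezoid \<Lambda> \<tau> l r" and pos: "0 < l" "\<Lambda> \<ge> 0" "\<Lambda> * \<tau> < 1"
    and c: "\<bar>c\<bar> \<le> \<Lambda> * x" and h: "0 \<le> h" "h \<le> t"
  shows "(t - h, x - c * h) \<in> trapezoid \<Lambda> \<tau> l r"
proof -
  note b = trapezoid_bounds[OF tx pos]
  have x: "0 < x" "0 < r" using b pos by linarith+
  have t: "0 \<le> t" "t \<le> \<tau>" "l \<le> x * (1 - \<Lambda> * t)" "x \<le> r * (1 - \<Lambda> * t)"
    using tx by (auto simp: mem_trapezoid)
  have ht: "0 \<le> \<Lambda> * h" "\<Lambda> * h \<le> \<Lambda> * t" using h pos by (auto intro: mult_left_mono)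
  have ch: "\<bar>c * h\<bar> \<le> x * (\<Lambda> * h)"
    using mult_right_mono[OF c h(1)] h by (simp add: abs_mult mult_ac)
  have "l \<le> x * (1 - \<Lambda> * t)" by fact
  also have "\<dots> \<le> x * ((1 - \<Lambda> * h) * (1 - \<Lambda> * (t - h)))"
  proof (rule mult_left_mono)
    have "(1 - \<Lambda> * h) * (1 - \<Lambda> * (t - h)) = 1 - \<Lambda> * t + (\<Lambda> * h) * (\<Lambda> * t - \<Lambda> * h)"
      by (simp add: algebra_simps)
    then show "1 - \<Lambda> * t \<le> (1 - \<Lambda> * h) * (1 - \<Lambda> * (t - h))" using ht by simp
  qed (use x in simp)
  also have "\<dots> = (x - x * (\<Lambda> * h)) * (1 - \<Lambda> * (t - h))" by (simp add: algebra_simps)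
  also have "\<dots> \<le> (x - c * h) * (1 - \<Lambda> * (t - h))"
    using ch b(3) ht by (intro mult_right_mono) (auto simp: algebra_simps)
  finally have 1: "l \<le> (x - c * h) * (1 - \<Lambda> * (t - h))" .
  have "x - c * h \<le> x * (1 + \<Lambda> * h)" using ch by (simp add: algebra_simps)
  also have "\<dots> \<le> r * (1 - \<Lambda> * t) * (1 + \<Lambda> * h)" using t ht by (intro mult_right_mono) auto
  also have "\<dots> = r * ((1 - \<Lambda> * t) * (1 + \<Lambda> * h))" by simp
  also have "\<dots> \<le> r * (1 - \<Lambda> * (t - h))"
  proof (rule mult_left_mono)
    have "(1 - \<Lambda> * t) * (1 + \<Lambda> * h) = 1 - \<Lambda> * (t - h) - (\<Lambda> * t) * (\<Lambda> * h)"
      by (simp add: algebra_simps)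
    then show "(1 - \<Lambda> * t) * (1 + \<Lambda> * h) \<le> 1 - \<Lambda> * (t - h)" using ht by simp
  qed (use x in simp)
  finally show ?thesis using 1 t h by (simp add: mem_trapezoid)
qed

section \<open>Minimum principle and transport estimate\<close>

text \<open>At a minimum point of positive time, a short step backwards in the direction
  \<open>(1, c)\<close> stays in the trapezoid and strictly lowers \<open>f\<close>. Hence the
  minimum is attained at time 0. Because the directional derivative is strictly positive, the
  tangent line can replace the characteristic curve, and no differential equation for
  characteristics has to be solved.\<close>

lemma trapezoid_minimum_principle:
  fixes f c :: "real \<Rightarrow> real \<Rightarrow> real"
  assumes pos: "0 < l" "\<Lambda> \<ge> 0" "\<Lambda> * \<tau> < 1"
    and cont: "continuous_on (trapezoid \<Lambda> \<tau> l r) (\<lambda>(t, x). f t x)"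
    and c: "\<And>t x. (t, x) \<in> trapezoid \<Lambda> \<tau> l r \<Longrightarrow> 0 < t \<Longrightarrow> \<bar>c t x\<bar> \<le> \<Lambda> * x"
    and increasing: "\<And>t x. (t, x) \<in> trapezoid \<Lambda> \<tau> l r \<Longrightarrow> 0 < t \<Longrightarrow> \<exists>p q.
      ((\<lambda>(t, x). f t x) has_derivative (\<lambda>(s, y). p * s + q * y)) (at (t, x)) \<and> p + c t x * q > 0"
    and init: "\<And>x. l \<le> x \<Longrightarrow> x \<le> r \<Longrightarrow> k \<le> f 0 x"
    and tx: "(t, x) \<in> trapezoid \<Lambda> \<tau> l r"
  shows "k \<le> f t x"
proof -
  obtain z where z: "z \<in> trapezoid \<Lambda> \<tau> l r"
    and min: "\<forall>w\<in>trapezoid \<Lambda> \<tau> l r. (case z of (t, x) \<Rightarrow> f t x) \<le> (case w of (t, x) \<Rightarrow> f t x)"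
    using continuous_attains_inf[OF compact_trapezoid[OF pos] _ cont] tx by blast
  obtain s y where sy: "z = (s, y)" by (cases z)
  have mem: "(s, y) \<in> trapezoid \<Lambda> \<tau> l r" using z sy by simp
  have "s = 0"
  proof (rule ccontr)
    assume "s \<noteq> 0"
    then have s: "s > 0" using mem by (simp add: mem_trapezoid)
    obtain p q where pq: "((\<lambda>(t, x). f t x) has_derivative (\<lambda>(s, y). p * s + q * y)) (at (s, y))"
      "p + c s y * q > 0"
      using increasing[OF mem s] by blast
    have line: "((\<lambda>h. (s - h, y - c s y * h)) has_derivative (\<lambda>h. (- h, - (c s y * h)))) (at 0)"
      by (auto intro!: derivative_eq_intros)
    have "((\<lambda>(t, x). f t x) has_derivative (\<lambda>(s, y). p * s + q * y)) (at (s - 0, y - c s y * 0))"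
      using pq(1) by simp
    from has_derivative_compose[OF line this] have "((\<lambda>h. f (s - h) (y - c s y * h)) has_derivative
        (\<lambda>h. p * - h + q * - (c s y * h))) (at 0)"
      by (simp only: prod.case)
    also have "(\<lambda>h. p * - h + q * - (c s y * h)) = (*) (- (p + c s y * q))"
      by (simp add: fun_eq_iff algebra_simps)
    finally have "DERIV (\<lambda>h. f (s - h) (y - c s y * h)) 0 :> - (p + c s y * q)"
      by (simp add: has_field_derivative_def)
    from DERIV_neg_dec_right[OF this] pq(2) obtain d where d: "d > 0"
      "\<And>h. 0 < h \<Longrightarrow> h < d \<Longrightarrow> f (s - h) (y - c s y * h) < f s y" by auto
    \<comment> \<open>The cap \<open>s\<close> prevents the step from going below time 0.\<close>
    define h where "h = min (d/2) s"
    have h: "0 < h" "h < d" "h \<le> s" using d s by (auto simp: h_def)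
    then have "(s - h, y - c s y * h) \<in> trapezoid \<Lambda> \<tau> l r"
      using trapezoid_backward[OF mem pos c[OF mem s]] by simp
    with min d(2)[OF h(1,2)] show False by (force simp: sy)
  qed
  then have "k \<le> f s y" using init trapezoid_bounds[OF mem pos] by auto
  also have "\<dots> \<le> f t x" using min tx by (force simp: sy)
  finally show ?thesis .
qed

text \<open>The minimum principle is applied to \<open>f * x powr (- \<beta>) + N * B * t\<close>.
  Along the characteristic direction the source contributes at least \<open>- \<Lambda> * B\<close>,
  differentiating the weight at least \<open>- \<beta> * \<Lambda> * B\<close> because
  \<open>\<bar>c / x\<bar> \<le> \<Lambda>\<close>, and the term in \<open>t\<close> adds
  \<open>N * B\<close>, which outweighs both by the choice of \<open>N\<close>.\<close>

lemma transport_lower_bound: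
  fixes f c :: "real \<Rightarrow> real \<Rightarrow> real"
  assumes pos: "0 < l" "\<Lambda> \<ge> 0" "\<Lambda> * \<tau> < 1"
    and cont: "continuous_on (trapezoid \<Lambda> \<tau> l r) (\<lambda>(t, x). f t x)"
    and c: "\<And>t x. (t, x) \<in> trapezoid \<Lambda> \<tau> l r \<Longrightarrow> 0 < t \<Longrightarrow> \<bar>c t x\<bar> \<le> \<Lambda> * x"
    and equation: "\<And>t x. (t, x) \<in> trapezoid \<Lambda> \<tau> l r \<Longrightarrow> 0 < t \<Longrightarrow> \<exists>p q.
      ((\<lambda>(t, x). f t x) has_derivative (\<lambda>(s, y). p * s + q * y)) (at (t, x)) \<and>
      \<bar>p + c t x * q\<bar> \<le> \<Lambda> * B * x powr \<beta>"
    and bound: "\<And>t x. (t, x) \<in> trapezoid \<Lambda> \<tau> l r \<Longrightarrow> \<bar>f t x\<bar> \<le> B * x powr \<beta>"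
    and B: "B > 0" and \<beta>: "\<beta> > 0" and N: "(\<beta> + 1) * \<Lambda> < N"
    and init: "\<And>x. l \<le> x \<Longrightarrow> x \<le> r \<Longrightarrow> k * x powr \<beta> \<le> f 0 x"
    and tx: "(t, x) \<in> trapezoid \<Lambda> \<tau> l r"
  shows "(k - N * B * t) * x powr \<beta> \<le> f t x"
proof -
  have xpos: "0 < x" if "(t, x) \<in> trapezoid \<Lambda> \<tau> l r" for t x
    using trapezoid_bounds(1)[OF that pos] pos by linarith
  have "k \<le> f t x * x powr (- \<beta>) + N * B * t"
  proof (rule trapezoid_minimum_principle[OF pos _ c _ _ tx, where f="\<lambda>t x. f t x * x powr (- \<beta>) + N * B * t"])
    have "continuous_on (trapezoid \<Lambda> \<tau> l r) (\<lambda>z. (case z of (t, x) \<Rightarrow> f t x) * snd z powr (- \<beta>) + N * B * fst z)"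
      using cont by (intro continuous_intros) (auto dest: xpos)
    then show "continuous_on (trapezoid \<Lambda> \<tau> l r) (\<lambda>(t, x). f t x * x powr (- \<beta>) + N * B * t)"
      by (simp add: split_beta)
  next
    fix x assume x: "l \<le> x" "x \<le> r"
    then have "x > 0" using pos by simp
    have "k = (k * x powr \<beta>) * x powr (- \<beta>)" using \<open>x > 0\<close> by (simp add: powr_minus)
    also have "\<dots> \<le> f 0 x * x powr (- \<beta>)" using init[OF x] by (intro mult_right_mono) auto
    finally show "k \<le> f 0 x * x powr (- \<beta>) + N * B * 0" by simp
  next
    fix t x assume tx: "(t, x) \<in> trapezoid \<Lambda> \<tau> l r" and t: "0 < t"
    note x = xpos[OF tx]
    obtain p q where pq: "((\<lambda>(t, x). f t x) has_derivative (\<lambda>(s, y). p * s + q * y)) (at (t, x))"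
      "\<bar>p + c t x * q\<bar> \<le> \<Lambda> * B * x powr \<beta>"
      using equation[OF tx t] by blast
    let ?p = "p * x powr (- \<beta>) + N * B"
    let ?q = "q * x powr (- \<beta>) - \<beta> * f t x * x powr (- \<beta> - 1)"
    have pow: "((\<lambda>z. snd z powr (- \<beta>)) has_derivative
        (\<lambda>z. snd z * (- \<beta> * x powr (- \<beta> - 1)))) (at (t, x))"
    proof -
      have "(*) (- \<beta> * x powr (- \<beta> - 1)) = (\<lambda>y. y * (- \<beta> * x powr (- \<beta> - 1)))"
        by (simp add: fun_eq_iff)
      with has_real_derivative_powr[OF x, of "- \<beta>"]
      have "((\<lambda>y. y powr (- \<beta>)) has_derivative (\<lambda>y. y * (- \<beta> * x powr (- \<beta> - 1)))) (at (snd (t, x)))"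
        by (simp only: has_field_derivative_def snd_conv)
      from has_derivative_compose[OF has_derivative_snd[OF has_derivative_ident] this]
      show ?thesis by simp
    qed
    have fst': "((\<lambda>z. N * B * fst z) has_derivative (\<lambda>z. N * B * fst z)) (at (t, x))"
      by (intro derivative_intros)
    have "((\<lambda>z. (case z of (t, x) \<Rightarrow> f t x) * snd z powr (- \<beta>) + N * B * fst z) has_derivative
        (\<lambda>z. (case (t, x) of (t, x) \<Rightarrow> f t x) * (snd z * (- \<beta> * x powr (- \<beta> - 1))) +
          (case z of (s, y) \<Rightarrow> p * s + q * y) * snd (t, x) powr (- \<beta>) + N * B * fst z)) (at (t, x))"
      by (rule has_derivative_add[OF has_derivative_mult[OF pq(1) pow] fst'])
    then have "((\<lambda>(t, x). f t x * x powr (- \<beta>) + N * B * t) has_derivative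
        (\<lambda>(s, y). ?p * s + ?q * y)) (at (t, x))"
      by (simp add: split_beta' algebra_simps)
    moreover have "?p + c t x * ?q > 0"
    proof -
      have xx: "x powr (- \<beta> - 1) = x powr (- \<beta>) / x" using x by (simp add: powr_diff)
      have one: "x powr \<beta> * x powr (- \<beta>) = 1" using x by (simp add: powr_minus)
      have a1: "\<bar>(p + c t x * q) * x powr (- \<beta>)\<bar> \<le> \<Lambda> * B"
        using mult_right_mono[OF pq(2), of "x powr (- \<beta>)"] one by (simp add: abs_mult mult.assoc)
      have v: "\<bar>f t x * x powr (- \<beta>)\<bar> \<le> B"
        using mult_right_mono[OF bound[OF tx], of "x powr (- \<beta>)"] one by (simp add: abs_mult mult.assoc)
      have "\<bar>c t x / x\<bar> \<le> \<Lambda>" using c[OF tx t] x by (simp add: divide_simps abs_mult)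
      then have "\<bar>c t x / x\<bar> * \<bar>f t x * x powr (- \<beta>)\<bar> \<le> \<Lambda> * B"
        using v pos by (intro mult_mono) auto
      then have "\<beta> * (\<bar>c t x / x\<bar> * \<bar>f t x * x powr (- \<beta>)\<bar>) \<le> \<beta> * (\<Lambda> * B)"
        using \<beta> by (intro mult_left_mono) auto
      then have a2: "\<bar>\<beta> * (c t x / x * (f t x * x powr (- \<beta>)))\<bar> \<le> \<beta> * (\<Lambda> * B)"
        using \<beta> by (simp add: abs_mult)
      have "(\<beta> + 1) * \<Lambda> * B < N * B" using N B by simp
      then have "\<Lambda> * B + \<beta> * (\<Lambda> * B) < N * B" by (simp add: algebra_simps)
      moreover have "?p + c t x * ?q = (p + c t x * q) * x powr (- \<beta>) -
          \<beta> * (c t x / x * (f t x * x powr (- \<beta>))) + N * B"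
        by (simp add: xx algebra_simps)
      ultimately show ?thesis using a1 a2 unfolding abs_le_iff by linarith
    qed
    ultimately show "\<exists>p q. ((\<lambda>(t, x). f t x * x powr (- \<beta>) + N * B * t) has_derivative
        (\<lambda>(s, y). p * s + q * y)) (at (t, x)) \<and> p + c t x * q > 0" by blast
  qed
  then have "(k - N * B * t) * x powr \<beta> \<le> f t x * x powr (- \<beta>) * x powr \<beta>"
    by (intro mult_right_mono) auto
  also have "\<dots> = f t x" using xpos[OF tx] by (simp add: powr_minus)
  finally show ?thesis .
qed

section \<open>Bounds for the coupled system\<close>

text \<open>\<open>R\<close> is transported with speed \<open>- c\<close> and \<open>S\<close> with
  speed \<open>c\<close>; the coupling \<open>q * (R + S)\<close> is at most
  \<open>\<Lambda> * B * x powr \<beta>\<close> once both are bounded by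
  \<open>B * x powr \<beta>\<close>. So \<open>transport_lower_bound\<close> applies to
  \<open>R\<close>, \<open>- R\<close>, \<open>S\<close> and \<open>- S\<close> on a trapezoid
  through the given point.\<close>

lemma symmetric_system_bounds:
  fixes R S c q :: "real \<Rightarrow> real \<Rightarrow> real"
  assumes pos: "0 < r" "\<Lambda> \<ge> 0" "\<Lambda> * \<tau> < 1"
    and N: "(\<beta> + 1) * \<Lambda> < N" "N * \<tau> \<le> 1/2" and \<beta>: "\<beta> > 0" and k: "0 < k"
    and contR: "continuous_on ({0..\<tau>} \<times> {0<..r}) (\<lambda>(t, x). R t x)"
    and contS: "continuous_on ({0..\<tau>} \<times> {0<..r}) (\<lambda>(t, x). S t x)"
    and c: "\<And>t x. 0 < t \<Longrightarrow> t \<le> \<tau> \<Longrightarrow> 0 < x \<Longrightarrow> x \<le> r \<Longrightarrow> \<bar>c t x\<bar> \<le> \<Lambda> * x"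
    and q: "\<And>t x. 0 \<le> t \<Longrightarrow> t \<le> \<tau> \<Longrightarrow> 0 < x \<Longrightarrow> x \<le> r \<Longrightarrow> \<bar>q t x\<bar> \<le> \<Lambda> / 2"
    and R: "\<And>t x. 0 < t \<Longrightarrow> t \<le> \<tau> \<Longrightarrow> 0 < x \<Longrightarrow> x \<le> r \<Longrightarrow> \<exists>p p'.
      ((\<lambda>(t, x). R t x) has_derivative (\<lambda>(s, y). p * s + p' * y)) (at (t, x)) \<and>
      p - c t x * p' = q t x * (R t x + S t x)"
    and S: "\<And>t x. 0 < t \<Longrightarrow> t \<le> \<tau> \<Longrightarrow> 0 < x \<Longrightarrow> x \<le> r \<Longrightarrow> \<exists>p p'.
      ((\<lambda>(t, x). S t x) has_derivative (\<lambda>(s, y). p * s + p' * y)) (at (t, x)) \<and>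
      p + c t x * p' = - q t x * (R t x + S t x)"
    and initR: "\<And>x. 0 < x \<Longrightarrow> x \<le> r \<Longrightarrow> k * x powr \<beta> \<le> R 0 x \<and> R 0 x \<le> m * x powr \<beta>"
    and initS: "\<And>x. 0 < x \<Longrightarrow> x \<le> r \<Longrightarrow> k * x powr \<beta> \<le> S 0 x \<and> S 0 x \<le> m * x powr \<beta>"
    and t: "0 \<le> t" "t \<le> \<tau>" and x: "0 < x" "x \<le> r * (1 - \<Lambda> * \<tau>)"
  shows "(k - 2 * N * m * t) * x powr \<beta> \<le> R t x \<and> R t x \<le> 2 * m * x powr \<beta> \<and>
    (k - 2 * N * m * t) * x powr \<beta> \<le> S t x \<and> S t x \<le> 2 * m * x powr \<beta>"
proof -
  \<comment> \<open>This left edge puts \<open>(t, x)\<close> into the trapezoid for every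
    \<open>t\<close> up to \<open>\<tau>\<close>. It tends to 0 with \<open>x\<close>, so the final
    constants must not depend on it.\<close>
  define l where "l = x * (1 - \<Lambda> * \<tau>)"
  have l: "0 < l" using x pos by (simp add: l_def)
  note pos' = l pos(2,3)
  let ?\<Omega> = "trapezoid \<Lambda> \<tau> l r"
  have \<Lambda>t: "\<Lambda> * t \<le> \<Lambda> * \<tau>" using t pos by (intro mult_left_mono) auto
  have tx: "(t, x) \<in> ?\<Omega>"
    unfolding mem_trapezoid l_def
  proof (intro conjI t)
    show "x * (1 - \<Lambda> * \<tau>) \<le> x * (1 - \<Lambda> * t)" using \<Lambda>t x by (intro mult_left_mono) auto
    have "r * (1 - \<Lambda> * \<tau>) \<le> r * (1 - \<Lambda> * t)" using \<Lambda>t pos by (intro mult_left_mono) auto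
    then show "x \<le> r * (1 - \<Lambda> * t)" using x by linarith
  qed
  have mem: "0 \<le> t \<and> t \<le> \<tau> \<and> 0 < x \<and> x \<le> r" if "(t, x) \<in> ?\<Omega>" for t x
    using trapezoid_bounds[OF that pos'] that l by (auto simp: mem_trapezoid)
  then have sub: "?\<Omega> \<subseteq> {0..\<tau>} \<times> {0<..r}" by auto
  note cR = continuous_on_subset[OF contR sub]
  note cS = continuous_on_subset[OF contS sub]
  \<comment> \<open>The weighted size of the pair; it has a finite maximum because the trapezoid is
    compact and keeps away from \<open>x = 0\<close>.\<close>
  define g where "g = (\<lambda>z. max (\<bar>case z of (t, x) \<Rightarrow> R t x\<bar>) (\<bar>case z of (t, x) \<Rightarrow> S t x\<bar>) * snd z powr (- \<beta>))"
  have "continuous_on ?\<Omega> g"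
    unfolding g_def using cR cS by (intro continuous_intros) (auto dest: mem)
  then obtain z where z: "z \<in> ?\<Omega>" and max: "\<forall>w\<in>?\<Omega>. g w \<le> g z"
    using continuous_attains_sup[OF compact_trapezoid[OF pos']] tx by blast
  \<comment> \<open>The a priori bound \<open>B\<close> depends on \<open>l\<close>; the minimum principle gives \<open>B \<le> m + B / 2\<close>,
    which removes this dependence.\<close>
  define B where "B = g z"
  have le_B: "\<bar>R t x\<bar> \<le> B * x powr \<beta> \<and> \<bar>S t x\<bar> \<le> B * x powr \<beta>" if "(t, x) \<in> ?\<Omega>" for t x
  proof -
    have "max (\<bar>R t x\<bar>) (\<bar>S t x\<bar>) * x powr (- \<beta>) \<le> B" using max that by (force simp: B_def g_def)
    then have "max (\<bar>R t x\<bar>) (\<bar>S t x\<bar>) * x powr (- \<beta>) * x powr \<beta> \<le> B * x powr \<beta>"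
      by (intro mult_right_mono) auto
    moreover have "max (\<bar>R t x\<bar>) (\<bar>S t x\<bar>) * x powr (- \<beta>) * x powr \<beta> = max (\<bar>R t x\<bar>) (\<bar>S t x\<bar>)"
      using mem[OF that] by (simp add: powr_minus)
    ultimately show ?thesis by simp
  qed
  \<comment> \<open>Comparing the initial lower bound at this point with \<open>B\<close> gives
    \<open>k \<le> B\<close>, hence the positivity of \<open>B\<close>.\<close>
  have x0: "(0, x) \<in> ?\<Omega>"
    using tx \<open>0 \<le> t\<close> pos x mult_left_mono[OF t(1) pos(2)]
    by (auto simp: mem_trapezoid l_def mult_le_cancel_left1 intro: order_trans[OF x(2)])
  have xr: "x \<le> r" using mem[OF tx] by simp
  have "k * x powr \<beta> \<le> B * x powr \<beta>" using le_B[OF x0] initR[OF x(1) xr] by linarith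
  then have kB: "k \<le> B" using x by simp
  then have B: "B > 0" using k by simp
  have *: "\<bar>q t x * (R t x + S t x)\<bar> \<le> \<Lambda> * B * x powr \<beta>" if "(t, x) \<in> ?\<Omega>" for t x
  proof -
    have "\<bar>q t x\<bar> * \<bar>R t x + S t x\<bar> \<le> \<Lambda> / 2 * (2 * (B * x powr \<beta>))"
      using le_B[OF that] q[of t x] mem[OF that] pos by (intro mult_mono) auto
    then show ?thesis by (simp add: abs_mult)
  qed
  have cc: "\<bar>c t x\<bar> \<le> \<Lambda> * x" "\<bar>- c t x\<bar> \<le> \<Lambda> * x" if "(t, x) \<in> ?\<Omega>" "0 < t" for t x
    using c mem[OF that(1)] that(2) by auto
  \<comment> \<open>Upper bounds for \<open>R\<close> and \<open>S\<close> are obtained as lower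
    bounds for their negatives, which have the same speed and the same bound on the source.\<close>
  have neg: "((\<lambda>(t, x). - f t x) has_derivative (\<lambda>(s, y). (- p) * s + (- p') * y)) F"
    if "((\<lambda>(t, x). f t x) has_derivative (\<lambda>(s, y). p * s + p' * y)) F" for f :: "real \<Rightarrow> real \<Rightarrow> real" and p p' F
    using has_derivative_minus[OF that] by (simp add: split_beta')
  have R1: "\<exists>p p'. ((\<lambda>(t, x). R t x) has_derivative (\<lambda>(s, y). p * s + p' * y)) (at (t, x)) \<and>
      \<bar>p + (- c t x) * p'\<bar> \<le> \<Lambda> * B * x powr \<beta>" if "(t, x) \<in> ?\<Omega>" "0 < t" for t x
    using R[of t x] mem[OF that(1)] *[OF that(1)] that by fastforce
  have R2: "\<exists>p p'. ((\<lambda>(t, x). - R t x) has_derivative (\<lambda>(s, y). p * s + p' * y)) (at (t, x)) \<and>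
      \<bar>p + (- c t x) * p'\<bar> \<le> \<Lambda> * B * x powr \<beta>" if tx: "(t, x) \<in> ?\<Omega>" "0 < t" for t x
  proof -
    obtain p p' where p: "((\<lambda>(t, x). R t x) has_derivative (\<lambda>(s, y). p * s + p' * y)) (at (t, x))"
      "\<bar>p + (- c t x) * p'\<bar> \<le> \<Lambda> * B * x powr \<beta>" using R1[OF tx] by blast
    show ?thesis using neg[OF p(1)] p(2) by (intro exI[of _ "-p"] exI[of _ "-p'"]) auto
  qed
  have S1: "\<exists>p p'. ((\<lambda>(t, x). S t x) has_derivative (\<lambda>(s, y). p * s + p' * y)) (at (t, x)) \<and>
      \<bar>p + c t x * p'\<bar> \<le> \<Lambda> * B * x powr \<beta>" if "(t, x) \<in> ?\<Omega>" "0 < t" for t x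
    using S[of t x] mem[OF that(1)] *[OF that(1)] that by fastforce
  have S2: "\<exists>p p'. ((\<lambda>(t, x). - S t x) has_derivative (\<lambda>(s, y). p * s + p' * y)) (at (t, x)) \<and>
      \<bar>p + c t x * p'\<bar> \<le> \<Lambda> * B * x powr \<beta>" if tx: "(t, x) \<in> ?\<Omega>" "0 < t" for t x
  proof -
    obtain p p' where p: "((\<lambda>(t, x). S t x) has_derivative (\<lambda>(s, y). p * s + p' * y)) (at (t, x))"
      "\<bar>p + c t x * p'\<bar> \<le> \<Lambda> * B * x powr \<beta>" using S1[OF tx] by blast
    show ?thesis using neg[OF p(1)] p(2) by (intro exI[of _ "-p"] exI[of _ "-p'"]) auto
  qed
  have cn: "continuous_on ?\<Omega> (\<lambda>(t, x). - R t x)" "continuous_on ?\<Omega> (\<lambda>(t, x). - S t x)"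
    using continuous_on_minus[OF cR] continuous_on_minus[OF cS] by (simp_all add: split_beta')
  have init: "k * x powr \<beta> \<le> R 0 x" "(- m) * x powr \<beta> \<le> - R 0 x"
    "k * x powr \<beta> \<le> S 0 x" "(- m) * x powr \<beta> \<le> - S 0 x" if "l \<le> x" "x \<le> r" for x
    using initR[of x] initS[of x] that l by auto
  have bounds: "(k - N * B * t) * x powr \<beta> \<le> R t x" "(- m - N * B * t) * x powr \<beta> \<le> - R t x"
    "(k - N * B * t) * x powr \<beta> \<le> S t x" "(- m - N * B * t) * x powr \<beta> \<le> - S t x"
    if tx: "(t, x) \<in> ?\<Omega>" for t x
    using transport_lower_bound[OF pos' cR cc(2) R1 _ B \<beta> N(1) init(1) tx]
      transport_lower_bound[OF pos' cn(1) cc(2) R2 _ B \<beta> N(1) init(2) tx]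
      transport_lower_bound[OF pos' cS cc(1) S1 _ B \<beta> N(1) init(3) tx]
      transport_lower_bound[OF pos' cn(2) cc(1) S2 _ B \<beta> N(1) init(4) tx]
      le_B by simp_all
  have N0: "0 < N" using N(1) \<beta> pos by (smt (verit) mult_nonneg_nonneg)
  have NB: "0 \<le> N * B * t \<and> N * B * t \<le> B / 2" if "(t, x) \<in> ?\<Omega>" for t x
  proof -
    have "N * t \<le> N * \<tau>" using mem[OF that] N0 by (intro mult_left_mono) auto
    then have "N * t \<le> 1/2" using N by linarith
    then have "(N * t) * B \<le> 1/2 * B" using B by (intro mult_right_mono) auto
    then show ?thesis using mem[OF that] N0 B by (simp add: mult_ac)
  qed
  \<comment> \<open>\<open>k \<le> m\<close> makes \<open>m\<close> positive, so
    \<open>k - N * B * s\<close> also lies above \<open>- m - B / 2\<close>, and the absolute values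
    can be estimated.\<close>
  have "k * x powr \<beta> \<le> m * x powr \<beta>" using initR[OF x(1) xr] by linarith
  then have km: "k \<le> m" using x by simp
  have B2m: "B \<le> 2 * m"
  proof -
    obtain s y where sy: "z = (s, y)" by (cases z)
    have mz: "(s, y) \<in> ?\<Omega>" using z sy by simp
    have y: "0 < y" using mem[OF mz] by simp
    have nb: "0 \<le> N * B * s" "N * B * s \<le> B / 2" using NB[OF mz] by auto
    have le: "(- m - B / 2) * y powr \<beta> \<le> (- m - N * B * s) * y powr \<beta>"
      "(- m - B / 2) * y powr \<beta> \<le> (k - N * B * s) * y powr \<beta>"
      using nb k km by (auto intro!: mult_right_mono)
    then have "max (\<bar>R s y\<bar>) (\<bar>S s y\<bar>) \<le> (m + B / 2) * y powr \<beta>"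
      using bounds[OF mz] by (auto simp: algebra_simps abs_le_iff)
    then have "max (\<bar>R s y\<bar>) (\<bar>S s y\<bar>) * y powr (- \<beta>) \<le> (m + B / 2) * y powr \<beta> * y powr (- \<beta>)"
      by (intro mult_right_mono) auto
    moreover have "B = max (\<bar>R s y\<bar>) (\<bar>S s y\<bar>) * y powr (- \<beta>)" by (simp add: B_def g_def sy)
    moreover have "y powr \<beta> * y powr (- \<beta>) = 1" using y by (simp add: powr_minus)
    ultimately have "B \<le> m + B / 2" by (simp add: mult.assoc)
    then show ?thesis by simp
  qed
  have "N * t * B \<le> N * t * (2 * m)" using B2m N0 t by (intro mult_left_mono) auto
  then have "(k - 2 * N * m * t) * x powr \<beta> \<le> (k - N * B * t) * x powr \<beta>"
    by (intro mult_right_mono) (auto simp: algebra_simps)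
  moreover have "B * x powr \<beta> \<le> 2 * m * x powr \<beta>" using B2m by (intro mult_right_mono) auto
  ultimately show ?thesis using bounds[OF tx] le_B[OF tx] by linarith
qed

section \<open>Passage to ordinary derivatives in the interior\<close>

text \<open>At an interior point the slices of \<open>D\<close> are neighbourhoods of the
  coordinates, so derivatives within them are the usual two-sided ones. The third fact speaks of a
  separate function \<open>v\<close> because the equation differentiates the product
  \<open>u powr a * partial_x D u\<close>.\<close>

lemma
  assumes diff: "partially_differentiable_on u D" and z: "(t, x) \<in> interior D"
  shows has_real_derivative_partial_t: "((\<lambda>s. u s x) has_real_derivative partial_t D u t x) (at t)"
    and has_real_derivative_partial_x: "((\<lambda>y. u t y) has_real_derivative partial_x D u t x) (at x)"
    and partial_x_eqI: "((\<lambda>y. v t y) has_real_derivative d) (at x) \<Longrightarrow> partial_x D v t x = d"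
proof -
  have tx: "(t, x) \<in> D" using z interior_subset by blast
  have op: "open ((\<lambda>s. (s, x)) -` interior D)" "open ((\<lambda>y. (t, y)) -` interior D)"
    by (intro open_vimage open_interior continuous_intros)+
  have slice: "at t within {s. (s, x) \<in> D} = at t" "at x within {y. (t, y) \<in> D} = at x"
    by (rule at_within_open_subset[OF _ op(1)] at_within_open_subset[OF _ op(2)];
        use z interior_subset[of D] in auto)+
  show "((\<lambda>s. u s x) has_real_derivative partial_t D u t x) (at t)"
    and "((\<lambda>y. u t y) has_real_derivative partial_x D u t x) (at x)"
    using diff tx slice
    by (auto simp: partially_differentiable_on_def partial_t_def partial_x_def
        has_real_derivative_iff_has_vector_derivative simp flip: vector_derivative_works)
  show "((\<lambda>y. v t y) has_real_derivative d) (at x) \<Longrightarrow> partial_x D v t x = d"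
    by (simp add: partial_x_def slice has_real_derivative_iff_has_vector_derivative vector_derivative_at)
qed

theorem theorem1p4:
  fixes a \<alpha> \<beta> T \<delta> K\<^sub>0 K\<^sub>1 K\<^sub>2 K\<^sub>3 :: real
    and u\<^sub>0 u\<^sub>1 :: "real \<Rightarrow> real"
    and u u\<^sub>t w :: "real \<Rightarrow> real \<Rightarrow> real"
    and D Q :: "(real \<times> real) set"
  defines "D \<equiv> {0..T} \<times> {0<..\<delta>}"
    and "Q \<equiv> {0..T} \<times> {0..\<delta>}"
  assumes "a \<ge> 1" and "\<alpha> > \<beta>" and "\<beta> > 0" and "T > 0" and "\<delta> > 0"
    and "K\<^sub>0 > 0" and "K\<^sub>1 > 0" and "K\<^sub>2 > 0" and "K\<^sub>3 > 0"
    and u0_bounds: "\<forall>x\<in>{0..\<delta>}. K\<^sub>0 * x powr \<alpha> \<le> u\<^sub>0 x \<and> u\<^sub>0 x \<le> K\<^sub>1 * x powr \<alpha>"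
    and u1_bounds: "\<forall>x\<in>{0..\<delta>}. K\<^sub>2 * x powr \<beta> \<le> u\<^sub>1 x \<and> u\<^sub>1 x \<le> K\<^sub>3 * x powr \<beta>"
    and u_C2: "Ck_on 2 D u"
    and u_cont: "continuous_on Q (\<lambda>(t, x). u t x)"
    and ut_cont: "continuous_extension D Q (partial_t D u) u\<^sub>t"
    and flux_cont: "continuous_extension D Q (\<lambda>t x. pow01 (u t x) (a - 1) * partial_x D u t x) w"
    and equation: "\<forall>(t, x)\<in>D. partial_t D (partial_t D u) t x =
          u t x powr a * partial_x D (\<lambda>t x. u t x powr a * partial_x D u t x) t x"
    and initial: "\<forall>x\<in>{0..\<delta>}. u 0 x = u\<^sub>0 x \<and> u\<^sub>t 0 x = u\<^sub>1 x"
    and boundary: "\<forall>t\<in>{0..T}. u t 0 = 0 \<and> u\<^sub>t t 0 = 0"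
    and nonneg: "\<forall>(t, x)\<in>Q. u t x \<ge> 0"
  shows "\<exists>T\<^sub>1 \<delta>\<^sub>1 C\<^sub>1 C\<^sub>2. 0 < T\<^sub>1 \<and> T\<^sub>1 \<le> T \<and> 0 < \<delta>\<^sub>1 \<and> \<delta>\<^sub>1 < \<delta> \<and> C\<^sub>1 > 0 \<and> C\<^sub>2 > 0 \<and>
    (\<forall>(t, x) \<in> {0..T\<^sub>1} \<times> {0..\<delta>\<^sub>1}. C\<^sub>1 * t * x powr \<beta> \<le> u t x \<and> u t x \<le> C\<^sub>2 * x powr \<beta>)"
proof -

  \<comment> \<open>Interior derivatives of the solution\<close>
  \<comment> \<open>All differentiation happens on this open set; \<open>\<tau> < T\<close> and
    \<open>r < \<delta>\<close> are arranged later so that the points with positive time and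
    positive \<open>x\<close> lie in it.\<close>
  define G where "G = {0<..<T} \<times> {0<..<\<delta>}"
  have G: "interior D = G"
    using \<open>T > 0\<close> \<open>\<delta> > 0\<close> by (simp add: G_def D_def interior_Times)
  have openG: "open G" unfolding G_def by (intro open_Times open_greaterThanLessThan)
  have GD: "G \<subseteq> D" and DQ: "D \<subseteq> Q" by (auto simp: G_def D_def Q_def)
  define ut where "ut = partial_t D u"
  define ux where "ux = partial_x D u"
  define utt where "utt = partial_t D ut"
  define utx where "utx = partial_x D ut"
  define uxt where "uxt = partial_t D ux"
  define uxx where "uxx = partial_x D ux"
  have "Ck_on (Suc (Suc 0)) D u" using u_C2 by (simp add: numeral_2_eq_2)
  then have diff: "partially_differentiable_on u D" "partially_differentiable_on ut D"
      "partially_differentiable_on ux D"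
    and cont: "continuous_on D (\<lambda>(t, x). ut t x)" "continuous_on D (\<lambda>(t, x). ux t x)"
      "continuous_on D (\<lambda>(t, x). utx t x)" "continuous_on D (\<lambda>(t, x). uxt t x)"
      "continuous_on D (\<lambda>(t, x). uxx t x)"
    by (auto simp: ut_def ux_def utx_def uxt_def uxx_def)
  have contG: "continuous_on G (\<lambda>(t, x). utx t x)" "continuous_on G (\<lambda>(t, x). uxt t x)"
    "continuous_on G (\<lambda>(t, x). uxx t x)" "continuous_on G (\<lambda>(t, x). ux t x)"
    using cont GD by (auto intro: continuous_on_subset)
  have der: "((\<lambda>s. u s x) has_real_derivative ut t x) (at t)"
    "((\<lambda>y. u t y) has_real_derivative ux t x) (at x)"
    "((\<lambda>s. ut s x) has_real_derivative utt t x) (at t)"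
    "((\<lambda>y. ut t y) has_real_derivative utx t x) (at x)"
    "((\<lambda>s. ux s x) has_real_derivative uxt t x) (at t)"
    "((\<lambda>y. ux t y) has_real_derivative uxx t x) (at x)"
    if "(t, x) \<in> G" for t x
    using has_real_derivative_partial_t[of _ D] has_real_derivative_partial_x[of _ D] diff that
    by (auto simp: ut_def ux_def utt_def utx_def uxt_def uxx_def G)
  have mixed: "utx t x = uxt t x" if "(t, x) \<in> G" for t x
    using mixed_partials_eq[OF openG that der(1,2,4,5) contG(1,2)] by blast
  have u_nonneg: "u t x \<ge> 0" if "(t, x) \<in> Q" for t x
    using nonneg that by auto
  have u_contD: "continuous_on D (\<lambda>(t, x). u t x)"
    using u_cont DQ by (rule continuous_on_subset)

  \<comment> \<open>Wave speed, flux and the first-order form of the equation\<close>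
  define p where "p = (\<lambda>t x. pow01 (u t x) (a - 1) * ux t x)"
  define c where "c = (\<lambda>t x. u t x powr a)"
  define F where "F = (\<lambda>t x. c t x * ux t x)"
  \<comment> \<open>The product rule, arranged so that the derivative of \<open>c\<close> enters
    only through \<open>p\<close>, the quantity bounded by hypothesis.\<close>
  define Ft where "Ft = (\<lambda>t x. a * p t x * ut t x + c t x * uxt t x)"
  define Fx where "Fx = (\<lambda>t x. a * p t x * ux t x + c t x * uxx t x)"
  have F_eq: "F t x = u t x * p t x" if "(t, x) \<in> Q" for t x
    using powr_eq_mult_pow01[OF u_nonneg[OF that]] by (simp add: F_def c_def p_def)
  \<comment> \<open>The power is differentiated within the image of \<open>h\<close>, a subset of
    the nonnegative reals, since at 0 only its right derivative is available. Openness of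
    \<open>A\<close> then restores the two-sided derivative.\<close>
  have chain: "((\<lambda>s. h s powr a) has_real_derivative (a * pow01 (h s) (a - 1)) * d) (at s)"
    if "(h has_real_derivative d) (at s)" "open A" "s \<in> A" "\<And>r. r \<in> A \<Longrightarrow> h r \<ge> 0"
    for h :: "real \<Rightarrow> real" and s d A
  proof -
    have "((\<lambda>y. y powr a) has_real_derivative a * pow01 (h s) (a - 1)) (at (h s) within h ` A)"
      using has_real_derivative_powr_nonneg[OF \<open>a \<ge> 1\<close> that(4)[OF that(3)]]
      by (rule DERIV_subset) (use that(4) in auto)
    moreover have "(h has_real_derivative d) (at s within A)"
      using that(1) by (rule has_field_derivative_at_within)
    ultimately have "((\<lambda>y. y powr a) \<circ> h has_real_derivative a * pow01 (h s) (a - 1) * d) (at s within A)"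
      by (rule DERIV_image_chain)
    then show ?thesis by (simp only: o_def at_within_open[OF that(3,2)])
  qed
  have derc: "((\<lambda>s. c s x) has_real_derivative (a * pow01 (u t x) (a - 1)) * ut t x) (at t)"
    "((\<lambda>y. c t y) has_real_derivative (a * pow01 (u t x) (a - 1)) * ux t x) (at x)"
    if "(t, x) \<in> G" for t x
    unfolding c_def using that
    by (intro chain[OF der(1)[OF that], of "{0<..<T}"] chain[OF der(2)[OF that], of "{0<..<\<delta>}"] u_nonneg;
        simp add: G_def Q_def)+
  have derF: "((\<lambda>s. F s x) has_real_derivative Ft t x) (at t)"
    "((\<lambda>y. F t y) has_real_derivative Fx t x) (at x)"
    if "(t, x) \<in> G" for t x
    using DERIV_mult[OF derc(1)[OF that] der(5)[OF that]] DERIV_mult[OF derc(2)[OF that] der(6)[OF that]]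
    by (auto simp: F_def Ft_def Fx_def p_def algebra_simps)
  have utt: "utt t x = c t x * Fx t x" if "(t, x) \<in> G" for t x
  proof -
    have "utt t x = c t x * partial_x D F t x"
      using equation that GD by (auto simp: utt_def ut_def F_def c_def ux_def)
    moreover have "partial_x D F t x = Fx t x"
      by (rule partial_x_eqI[where u=u]) (use diff that G derF(2)[OF that] in simp_all)
    ultimately show ?thesis by simp
  qed
  have cont_c: "continuous_on D (\<lambda>z. c (fst z) (snd z))"
    unfolding c_def using u_contD \<open>a \<ge> 1\<close> DQ u_nonneg
    by (intro continuous_on_powr') (auto simp: split_beta')
  have cont_p: "continuous_on D (\<lambda>z. p (fst z) (snd z))"
    unfolding p_def using u_contD cont(2) \<open>a \<ge> 1\<close> DQ u_nonneg
    by (intro continuous_intros continuous_on_pow01) (auto simp: split_beta')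
  have cont_F: "continuous_on D (\<lambda>(t, x). F t x)" and cont_Fx: "continuous_on G (\<lambda>(t, x). Fx t x)"
    using cont_c cont_p cont contG continuous_on_subset[OF cont_c GD] continuous_on_subset[OF cont_p GD]
    by (auto simp: split_beta' F_def Fx_def intro!: continuous_intros)

  \<comment> \<open>Bounds for the flux and the wave speed\<close>
  \<comment> \<open>The extension \<open>w\<close> is continuous on the compact rectangle, which
    bounds \<open>p\<close> uniformly up to \<open>x = 0\<close>.\<close>
  obtain M where M: "M > 0" and w_le: "\<And>t x. (t, x) \<in> Q \<Longrightarrow> \<bar>w t x\<bar> \<le> M"
  proof -
    have "compact Q" unfolding Q_def by (intro compact_Times compact_Icc)
    moreover have "continuous_on Q (\<lambda>(t, x). w t x)"
      using flux_cont by (simp add: continuous_extension_def)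
    ultimately have "bounded ((\<lambda>(t, x). w t x) ` Q)"
      by (intro compact_imp_bounded compact_continuous_image)
    then show ?thesis using that by (force simp: bounded_pos)
  qed
  have p_le: "\<bar>p t x\<bar> \<le> M" if "(t, x) \<in> D" for t x
  proof -
    have "w t x = p t x"
      using flux_cont that by (auto simp: continuous_extension_def p_def ux_def)
    then show ?thesis using w_le[of t x] that DQ by auto
  qed
  define \<Lambda> where "\<Lambda> = a * M"
  have \<Lambda>: "\<Lambda> \<ge> 0" using \<open>a \<ge> 1\<close> M by (simp add: \<Lambda>_def)
  \<comment> \<open>The mean value theorem in \<open>x\<close>, from \<open>c t 0 = 0\<close> and
    the derivative \<open>a * p\<close> of \<open>c t\<close>.\<close>
  have c_le: "\<bar>c t x\<bar> \<le> \<Lambda> * x" if t: "0 < t" "t < T" and x: "0 < x" "x < \<delta>" for t x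
  proof -
    have "continuous_on {0..x} (\<lambda>y. (\<lambda>(t, x). u t x) (t, y))"
      using t x by (intro continuous_on_compose2[OF u_cont] continuous_intros) (auto simp: Q_def)
    then have "continuous_on {0..x} (c t)"
      unfolding c_def using \<open>a \<ge> 1\<close> t x
      by (intro continuous_on_powr') (auto simp: Q_def intro!: u_nonneg)
    moreover have "(c t has_derivative (*) (a * pow01 (u t y) (a - 1) * ux t y)) (at y)"
      if "0 < y" "y < x" for y
      using derc(2)[of t y] that t x by (auto simp: G_def has_field_derivative_def)
    ultimately obtain y where y: "0 < y" "y < x"
      "c t x - c t 0 = a * pow01 (u t y) (a - 1) * ux t y * (x - 0)"
      by (rule mvt[OF x(1), where f="c t" and f'="\<lambda>y. (*) (a * pow01 (u t y) (a - 1) * ux t y)"])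
    moreover have "c t 0 = 0" using boundary t by (simp add: c_def)
    ultimately have "c t x = a * p t y * x" by (simp add: p_def)
    moreover have "\<bar>a * p t y * x\<bar> \<le> a * M * x"
      using p_le[of t y] y t x \<open>a \<ge> 1\<close> by (auto simp: D_def abs_mult intro!: mult_right_mono mult_left_mono)
    ultimately show ?thesis by (simp add: \<Lambda>_def)
  qed

  \<comment> \<open>Choice of the constants\<close>
  \<comment> \<open>The first entry keeps \<open>r\<close> below \<open>\<delta>\<close>; the second
    makes the initial value of \<open>F\<close>, at most
    \<open>M * K\<^sub>1 * x powr \<alpha>\<close>, no larger than half the lower bound for
    \<open>u\<^sub>1\<close>. This uses \<open>\<alpha> > \<beta>\<close>.\<close>
  define r where "r = min (\<delta> / 2) ((K\<^sub>2 / (2 * M * K\<^sub>1)) powr (1 / (\<alpha> - \<beta>)))"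
  have r: "0 < r" "r < \<delta>" using \<open>\<delta> > 0\<close> \<open>K\<^sub>1 > 0\<close> \<open>K\<^sub>2 > 0\<close> M by (auto simp: r_def)
  have r_small: "M * K\<^sub>1 * x powr \<alpha> \<le> K\<^sub>2 / 2 * x powr \<beta>" if "0 < x" "x \<le> r" for x
  proof -
    have "x powr (\<alpha> - \<beta>) \<le> ((K\<^sub>2 / (2 * M * K\<^sub>1)) powr (1 / (\<alpha> - \<beta>))) powr (\<alpha> - \<beta>)"
      using that \<open>\<alpha> > \<beta>\<close> by (intro powr_mono2) (auto simp: r_def)
    also have "\<dots> = K\<^sub>2 / (2 * M * K\<^sub>1)"
      using \<open>\<alpha> > \<beta>\<close> \<open>K\<^sub>1 > 0\<close> \<open>K\<^sub>2 > 0\<close> M by (simp add: powr_powr)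
    finally have "M * K\<^sub>1 * x powr (\<alpha> - \<beta>) \<le> K\<^sub>2 / 2"
      using \<open>K\<^sub>1 > 0\<close> M by (simp add: field_simps)
    then have "M * K\<^sub>1 * x powr (\<alpha> - \<beta>) * x powr \<beta> \<le> K\<^sub>2 / 2 * x powr \<beta>"
      by (intro mult_right_mono) auto
    moreover have "x powr (\<alpha> - \<beta>) * x powr \<beta> = x powr \<alpha>" by (simp flip: powr_add)
    ultimately show ?thesis by (simp add: mult.assoc)
  qed
  \<comment> \<open>\<open>k\<close> and \<open>m\<close> are what remains of
    \<open>K\<^sub>2\<close> and \<open>K\<^sub>3\<close> after a perturbation by
    \<open>K\<^sub>2 / 2\<close>. The summand 1 in \<open>N\<close> makes the inequality required of
    \<open>N\<close> strict.\<close>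
  define k where "k = K\<^sub>2 / 2"
  define m where "m = K\<^sub>3 + K\<^sub>2 / 2"
  define N where "N = (\<beta> + 1) * \<Lambda> + 1"
  \<comment> \<open>The three entries ensure \<open>\<tau> < T\<close>, then
    \<open>N * \<tau> \<le> 1 / 2\<close>, then that \<open>k - 2 * N * m * t\<close> stays at least
    \<open>k / 2\<close>.\<close>
  define \<tau> where "\<tau> = min (T / 2) (min (1 / (2 * N)) (k / (4 * N * m)))"
  have k: "k > 0" and m: "m > 0" using \<open>K\<^sub>2 > 0\<close> \<open>K\<^sub>3 > 0\<close> by (auto simp: k_def m_def)
  have "\<beta> * \<Lambda> \<ge> 0" using \<Lambda> \<open>\<beta> > 0\<close> by simp
  then have N: "N > 0" "\<Lambda> \<le> N" using \<Lambda> by (auto simp: N_def algebra_simps)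
  have \<tau>: "0 < \<tau>" "\<tau> < T" using N k m \<open>T > 0\<close> by (auto simp: \<tau>_def)
  have "\<tau> \<le> 1 / (2 * N)" "\<tau> \<le> k / (4 * N * m)" by (simp_all add: \<tau>_def)
  then have N\<tau>: "N * \<tau> \<le> 1 / 2" "2 * N * m * \<tau> \<le> k / 2" using N m by (simp_all add: field_simps)
  have \<Lambda>\<tau>: "\<Lambda> * \<tau> \<le> 1 / 2" using mult_right_mono[OF N(2), of \<tau>] \<tau> N\<tau> by linarith

  \<comment> \<open>The Riemann variables: initial bounds and equations\<close>
  let ?R = "\<lambda>t x. ut t x + F t x" and ?S = "\<lambda>t x. ut t x - F t x"
  have inG: "(t, x) \<in> G" if "0 < t" "t \<le> \<tau>" "0 < x" "x \<le> r" for t x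
    using that \<tau> r by (auto simp: G_def)
  have inD: "(t, x) \<in> D" if "0 \<le> t" "t \<le> \<tau>" "0 < x" "x \<le> r" for t x
    using that \<tau> r by (auto simp: D_def)
  have init: "k * x powr \<beta> \<le> ?R 0 x \<and> ?R 0 x \<le> m * x powr \<beta>"
    "k * x powr \<beta> \<le> ?S 0 x \<and> ?S 0 x \<le> m * x powr \<beta>" if x: "0 < x" "x \<le> r" for x
  proof -
    have x0: "(0, x) \<in> D" "x \<in> {0..\<delta>}" using inD[of 0 x] x \<tau> r by auto
    have "ut 0 x = u\<^sub>1 x"
      using ut_cont initial x0 by (auto simp: continuous_extension_def ut_def)
    then have 1: "K\<^sub>2 * x powr \<beta> \<le> ut 0 x" "ut 0 x \<le> K\<^sub>3 * x powr \<beta>" using u1_bounds x0 by auto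
    have "0 \<le> u 0 x" using u_nonneg x0 DQ by blast
    moreover have "u 0 x \<le> K\<^sub>1 * x powr \<alpha>" using initial u0_bounds x0 by auto
    ultimately have "\<bar>u 0 x\<bar> * \<bar>p 0 x\<bar> \<le> K\<^sub>1 * x powr \<alpha> * M"
      using p_le[OF x0(1)] by (intro mult_mono) auto
    also have "\<dots> \<le> K\<^sub>2 / 2 * x powr \<beta>" using r_small[OF x] by (simp add: mult_ac)
    finally have "\<bar>F 0 x\<bar> \<le> K\<^sub>2 / 2 * x powr \<beta>" using F_eq x0 DQ by (auto simp: abs_mult)
    with 1 show "k * x powr \<beta> \<le> ?R 0 x \<and> ?R 0 x \<le> m * x powr \<beta>"
      "k * x powr \<beta> \<le> ?S 0 x \<and> ?S 0 x \<le> m * x powr \<beta>"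
      by (auto simp: k_def m_def algebra_simps abs_le_iff)
  qed
  have total: "((\<lambda>(t, x). ut t x) has_derivative (\<lambda>(s, y). utt t x * s + utx t x * y)) (at (t, x))"
    "((\<lambda>(t, x). F t x) has_derivative (\<lambda>(s, y). Ft t x * s + Fx t x * y)) (at (t, x))"
    if tx: "(t, x) \<in> G" for t x
  proof -
    show "((\<lambda>(t, x). ut t x) has_derivative (\<lambda>(s, y). utt t x * s + utx t x * y)) (at (t, x))"
      by (rule has_derivative_from_partials[where ?t1.0=0 and ?t2.0=T and ?x1.0=0 and ?x2.0=\<delta>])
        (use tx der contG(1) in \<open>auto simp: G_def\<close>)
    show "((\<lambda>(t, x). F t x) has_derivative (\<lambda>(s, y). Ft t x * s + Fx t x * y)) (at (t, x))"
      by (rule has_derivative_from_partials[where ?t1.0=0 and ?t2.0=T and ?x1.0=0 and ?x2.0=\<delta>])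
        (use tx derF cont_Fx in \<open>auto simp: G_def\<close>)
  qed
  \<comment> \<open>With \<open>utt = c * Fx\<close> and equal mixed derivatives, everything cancels
    except \<open>a * p * ut\<close>, and \<open>ut\<close> is half of the sum of the two variables.
    The equation for the other variable follows in the same way.\<close>
  have R: "\<exists>d d'. ((\<lambda>(t, x). ?R t x) has_derivative (\<lambda>(s, y). d * s + d' * y)) (at (t, x)) \<and>
      d - c t x * d' = a / 2 * p t x * (?R t x + ?S t x)" if tx: "(t, x) \<in> G" for t x
  proof (intro exI conjI)
    show "((\<lambda>(t, x). ?R t x) has_derivative
        (\<lambda>(s, y). (utt t x + Ft t x) * s + (utx t x + Fx t x) * y)) (at (t, x))"
      using has_derivative_add[OF total[OF tx]] by (simp add: split_beta' algebra_simps)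
    show "utt t x + Ft t x - c t x * (utx t x + Fx t x) = a / 2 * p t x * (?R t x + ?S t x)"
      by (simp add: utt[OF tx] mixed[OF tx] Ft_def algebra_simps)
  qed
  have S: "\<exists>d d'. ((\<lambda>(t, x). ?S t x) has_derivative (\<lambda>(s, y). d * s + d' * y)) (at (t, x)) \<and>
      d + c t x * d' = - (a / 2 * p t x) * (?R t x + ?S t x)" if tx: "(t, x) \<in> G" for t x
  proof (intro exI conjI)
    show "((\<lambda>(t, x). ?S t x) has_derivative
        (\<lambda>(s, y). (utt t x - Ft t x) * s + (utx t x - Fx t x) * y)) (at (t, x))"
      using has_derivative_diff[OF total[OF tx]] by (simp add: split_beta' algebra_simps)
    show "utt t x - Ft t x + c t x * (utx t x - Fx t x) = - (a / 2 * p t x) * (?R t x + ?S t x)"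
      by (simp add: utt[OF tx] mixed[OF tx] Ft_def algebra_simps)
  qed

  \<comment> \<open>Two-sided bounds for the time derivative\<close>
  have "{0..\<tau>} \<times> {0<..r} \<subseteq> D" using inD by auto
  then have "continuous_on ({0..\<tau>} \<times> {0<..r}) (\<lambda>(t, x). ?R t x)"
    "continuous_on ({0..\<tau>} \<times> {0<..r}) (\<lambda>(t, x). ?S t x)"
    using continuous_on_subset[OF cont(1)] continuous_on_subset[OF cont_F]
    by (auto simp: split_beta' intro!: continuous_intros)
  note system = symmetric_system_bounds[OF r(1) \<Lambda> _ _ N\<tau>(1) \<open>\<beta> > 0\<close> k this,
      where q="\<lambda>t x. a / 2 * p t x" and c=c and m=m]
  have RS: "k / 2 * x powr \<beta> \<le> ?R t x \<and> ?R t x \<le> 2 * m * x powr \<beta> \<and>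
      k / 2 * x powr \<beta> \<le> ?S t x \<and> ?S t x \<le> 2 * m * x powr \<beta>"
    if t: "0 \<le> t" "t \<le> \<tau>" and x: "0 < x" "x \<le> r / 2" for t x
  proof -
    \<comment> \<open>Since \<open>\<Lambda> * \<tau> \<le> 1 / 2\<close>, the region up to
      \<open>r / 2\<close> lies in the range covered by
      \<open>symmetric_system_bounds\<close>.\<close>
    have "r * (1 / 2) \<le> r * (1 - \<Lambda> * \<tau>)" using r \<Lambda>\<tau> by (intro mult_left_mono) auto
    then have x': "x \<le> r * (1 - \<Lambda> * \<tau>)" using x by linarith
    have "(k - 2 * N * m * t) * x powr \<beta> \<le> ?R t x \<and> ?R t x \<le> 2 * m * x powr \<beta> \<and>
        (k - 2 * N * m * t) * x powr \<beta> \<le> ?S t x \<and> ?S t x \<le> 2 * m * x powr \<beta>"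
    proof (rule system)
      show "\<bar>a / 2 * p t x\<bar> \<le> \<Lambda> / 2" if "0 \<le> t" "t \<le> \<tau>" "0 < x" "x \<le> r" for t x
        using p_le[OF inD[OF that]] \<open>a \<ge> 1\<close> by (auto simp: abs_mult \<Lambda>_def)
      show "\<bar>c t x\<bar> \<le> \<Lambda> * x" if "0 < t" "t \<le> \<tau>" "0 < x" "x \<le> r" for t x
        using c_le[of t x] that \<tau> r by auto
      show "\<exists>d d'. ((\<lambda>(t, x). ?R t x) has_derivative (\<lambda>(s, y). d * s + d' * y)) (at (t, x)) \<and>
          d - c t x * d' = a / 2 * p t x * (?R t x + ?S t x)"
        if "0 < t" "t \<le> \<tau>" "0 < x" "x \<le> r" for t x using R[OF inG[OF that]] .
      show "\<exists>d d'. ((\<lambda>(t, x). ?S t x) has_derivative (\<lambda>(s, y). d * s + d' * y)) (at (t, x)) \<and>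
          d + c t x * d' = - (a / 2 * p t x) * (?R t x + ?S t x)"
        if "0 < t" "t \<le> \<tau>" "0 < x" "x \<le> r" for t x using S[OF inG[OF that]] .
      show "(\<beta> + 1) * \<Lambda> < N" by (simp add: N_def)
    qed (use init t x x' \<tau> \<Lambda>\<tau> in auto)
    moreover have "2 * N * m * t \<le> 2 * N * m * \<tau>" using t N m by (intro mult_left_mono) auto
    then have "k / 2 * x powr \<beta> \<le> (k - 2 * N * m * t) * x powr \<beta>"
      using N\<tau> by (intro mult_right_mono) auto
    ultimately show ?thesis by linarith
  qed
  then have ut_bounds: "k / 2 * x powr \<beta> \<le> ut t x \<and> ut t x \<le> 2 * m * x powr \<beta>"
    if "0 \<le> t" "t \<le> \<tau>" "0 < x" "x \<le> r / 2" for t x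
    using RS[OF that] by linarith

  \<comment> \<open>Integration in time\<close>
  \<comment> \<open>The first summand bounds the initial value, by the choice of \<open>r\<close>;
    the second comes from integrating \<open>2 * m * x powr \<beta>\<close> over a time of at most
    \<open>\<tau>\<close>.\<close>
  define C\<^sub>2 where "C\<^sub>2 = K\<^sub>2 / (2 * M) + 2 * m * \<tau>"
  have main: "k / 2 * t * x powr \<beta> \<le> u t x \<and> u t x \<le> C\<^sub>2 * x powr \<beta>"
    if t: "0 \<le> t" "t \<le> \<tau>" and x: "0 \<le> x" "x \<le> r / 2" for t x
  proof (cases "x = 0")
    case True
    then show ?thesis using boundary t \<tau> by auto
  next
    case False
    then have x: "0 < x" "x \<le> r / 2" "x \<le> r" "x \<le> \<delta>" using x r by auto
    have "M * u 0 x \<le> M * (K\<^sub>1 * x powr \<alpha>)"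
      using initial u0_bounds x M by (intro mult_left_mono) auto
    also have "\<dots> \<le> K\<^sub>2 / 2 * x powr \<beta>" using r_small[OF x(1,3)] by (simp add: mult_ac)
    finally have u0: "u 0 x \<le> K\<^sub>2 / (2 * M) * x powr \<beta>" using M by (simp add: field_simps)
    have "0 \<le> u 0 x" using u_nonneg x \<open>T > 0\<close> by (simp add: Q_def)
    \<comment> \<open>The mean value theorem in time needs a nondegenerate interval; for
      \<open>t = 0\<close> any admissible \<open>d\<close> serves. Continuity up to time 0 comes
      from \<open>u_cont\<close>, the derivative from the interior.\<close>
    have "\<exists>d. k / 2 * x powr \<beta> \<le> d \<and> d \<le> 2 * m * x powr \<beta> \<and> u t x - u 0 x = d * t"
    proof (cases "t = 0")
      case True
      then show ?thesis using ut_bounds[OF t x(1,2)] by auto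
    next
      case False
      then have "0 < t" using t by simp
      have "continuous_on {0..t} (\<lambda>s. (\<lambda>(t, x). u t x) (s, x))"
        using t \<tau> x by (intro continuous_on_compose2[OF u_cont] continuous_intros) (auto simp: Q_def)
      then have "continuous_on {0..t} (\<lambda>s. u s x)" by simp
      moreover have "((\<lambda>s. u s x) has_derivative (*) (ut s x)) (at s)" if "0 < s" "s < t" for s
        using der(1)[OF inG, of s x] that t x by (simp add: has_field_derivative_def)
      ultimately obtain s where s: "0 < s" "s < t" "u t x - u 0 x = ut s x * (t - 0)"
        by (rule mvt[OF \<open>0 < t\<close>, where f="\<lambda>s. u s x" and f'="\<lambda>s. (*) (ut s x)"])
      then show ?thesis using ut_bounds[of s x] t x by auto
    qed
    then obtain d where d: "k / 2 * x powr \<beta> \<le> d" "d \<le> 2 * m * x powr \<beta>" "u t x - u 0 x = d * t"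
      by blast
    have "k / 2 * x powr \<beta> * t \<le> d * t" using d t by (intro mult_right_mono) auto
    moreover have "d * t \<le> 2 * m * x powr \<beta> * \<tau>" using d t m by (intro mult_mono) auto
    ultimately show ?thesis using d(3) u0 \<open>0 \<le> u 0 x\<close> by (simp add: C\<^sub>2_def algebra_simps)
  qed
  \<comment> \<open>The witnesses are \<open>\<tau>\<close>, \<open>r / 2\<close>,
    \<open>k / 2\<close> and \<open>C\<^sub>2\<close>.\<close>
  show ?thesis
  proof (intro exI conjI)
    show "\<forall>(t, x) \<in> {0..\<tau>} \<times> {0..r / 2}. k / 2 * t * x powr \<beta> \<le> u t x \<and> u t x \<le> C\<^sub>2 * x powr \<beta>"
      using main by auto
    show "C\<^sub>2 > 0" using \<open>K\<^sub>2 > 0\<close> M m \<tau> by (simp add: C\<^sub>2_def add_pos_pos)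
  qed (use \<tau> r k in auto)
qed

end
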